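(* Let $X$ be a nonempty set, $Y$ a nonempty subset of $X$, and $f,g\in\overline{\Omega}(X,Y)$. Then $(f,g)\in\mathcal{H}$ in $\overline{\Omega}(X,Y)$ if and only if $Xf=Xg$, $\pi(f)=\pi(g)$, $\pi_f(Y)=\pi_g(Y)$, and $|y(f_{\upharpoonright Y})^{-1}|=|y(g_{\upharpoonright Y})^{-1}|$ for all $y\in Y$.
   Context: $T(X)$ is the semigroup of all maps $X\to X$ under composition; maps are written on the right and composed from left to right, so $x(fg)=(xf)g$, and for $B\subseteq X$, $Bf=\{xf\colon x\in B\}$. Let $\overline{\Omega}(X,Y)=\{f\in T(X)\colon Yf=Y\}$, a subsemigroup of $T(X)$ containing the identity map. For $f\in\overline{\Omega}(X,Y)$, $f_{\upharpoonright Y}\colon Y\to Y$ denotes the (surjective) map that agrees with $f$ on $Y$, and for $y\in Y$, $y(f_{\upharpoonright Y})^{-1}=\{z\in Y\colon zf=y\}$. $|A|$ denotes the cardinality of $A$. For $f\in T(X)$ and $x\in X$, $xf^{-1}=\{z\in X\colon zf=x\}$. For $A\subseteq X$ with $Xf\cap A\neq\emptyset$, let $\pi_f(A)=\{xf^{-1}\colon x\in Xf\cap A\}$, and let $\pi(f)=\pi_f(X)$, which is a partition of $X$. For subcollections $\mathcal{A}$, $\mathcal{B}$ of blocks of two partitions of $X$, $\mathcal{A}\preceq\mathcal{B}$ means that for every $A\in\mathcal{A}$ there is $B\in\mathcal{B}$ with $A\subseteq B$; $\mathcal{A}=\mathcal{B}$ means $\mathcal{A}\preceq\mathcal{B}$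 and $\mathcal{B}\preceq\mathcal{A}$. Green's relations on a semigroup $S$ with identity: $(a,b)\in\mathcal{L}$ iff $a=cb$ and $b=da$ for some $c,d\in S$; $(a,b)\in\mathcal{R}$ iff $a=bc$ and $b=ad$ for some $c,d\in S$; $\mathcal{H}=\mathcal{L}\cap\mathcal{R}$. *)

theory Defs
  imports "HOL-Algebra.Group" "HOL-Library.Equipollence"
begin

section \<open>Transformation semigroups\<close>

text \<open>
  Maps \<open>X \<rightarrow> X\<close> are represented by the functions in \<open>X \<rightarrow>\<^sub>E X\<close> (with the value
  \<open>undefined\<close> outside \<open>X\<close>), so that equality of functions is equality of maps on \<open>X\<close>.
  Maps are written on the right and composed from left to right, hence
  the product of \<open>f\<close> and \<open>g\<close> applies \<open>f\<close> first.
\<close>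

definition transf_monoid :: "'a set \<Rightarrow> ('a \<Rightarrow> 'a) monoid" where
  "transf_monoid X =
    \<lparr>carrier = X \<rightarrow>\<^sub>E X, mult = (\<lambda>f g. compose X g f), one = (\<lambda>x\<in>X. x)\<rparr>"

definition Omega_bar :: "'a set \<Rightarrow> 'a set \<Rightarrow> ('a \<Rightarrow> 'a) monoid" where
  "Omega_bar X Y =
    (transf_monoid X)\<lparr>carrier := {f \<in> carrier (transf_monoid X). f ` Y = Y}\<rparr>"

lemma Omega_bar_simps:
  "carrier (Omega_bar X Y) = {f \<in> X \<rightarrow>\<^sub>E X. f ` Y = Y}"
  "f \<otimes>\<^bsub>Omega_bar X Y\<^esub> g = compose X g f"
  "\<one>\<^bsub>Omega_bar X Y\<^esub> = (\<lambda>x\<in>X. x)"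
  by (simp_all add: Omega_bar_def transf_monoid_def)

lemma monoid_Omega_bar:
  assumes "Y \<subseteq> X"
  shows "monoid (Omega_bar X Y)"
proof
  fix f g
  assume f: "f \<in> carrier (Omega_bar X Y)" and g: "g \<in> carrier (Omega_bar X Y)"
  have "compose X g f ` Y = g ` (f ` Y)"
    using assms by (force simp: compose_def)
  then show "f \<otimes>\<^bsub>Omega_bar X Y\<^esub> g \<in> carrier (Omega_bar X Y)"
    using f g by (auto simp: Omega_bar_simps compose_def)
next
  show "\<one>\<^bsub>Omega_bar X Y\<^esub> \<in> carrier (Omega_bar X Y)"
    using assms by (force simp: Omega_bar_simps)
qed (auto simp: Omega_bar_simps compose_def fun_eq_iff PiE_def Pi_def extensional_def)

section \<open>Green's relations of a monoid\<close>

definition green_L :: "('a, 'b) monoid_scheme \<Rightarrow> ('a \<times> 'a) set" where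
  "green_L S = {(a, b). a \<in> carrier S \<and> b \<in> carrier S \<and>
     (\<exists>c\<in>carrier S. \<exists>d\<in>carrier S. a = c \<otimes>\<^bsub>S\<^esub> b \<and> b = d \<otimes>\<^bsub>S\<^esub> a)}"

definition green_R :: "('a, 'b) monoid_scheme \<Rightarrow> ('a \<times> 'a) set" where
  "green_R S = {(a, b). a \<in> carrier S \<and> b \<in> carrier S \<and>
     (\<exists>c\<in>carrier S. \<exists>d\<in>carrier S. a = b \<otimes>\<^bsub>S\<^esub> c \<and> b = a \<otimes>\<^bsub>S\<^esub> d)}"

definition green_H :: "('a, 'b) monoid_scheme \<Rightarrow> ('a \<times> 'a) set" where
  "green_H S = green_L S \<inter> green_R S"

section \<open>Kernel partitions\<close>

definition fibre :: "'a set \<Rightarrow> ('a \<Rightarrow> 'b) \<Rightarrow> 'b \<Rightarrow> 'a set" where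
  "fibre D f y = {z \<in> D. f z = y}"

text \<open>
  \<open>ker_blocks X f A\<close> is $\pi_f(A)$ for a map \<open>f\<close> on \<open>X\<close>, and \<open>ker_blocks X f X\<close> is
  the partition $\pi(f)$ of \<open>X\<close>.
\<close>

definition ker_blocks :: "'a set \<Rightarrow> ('a \<Rightarrow> 'a) \<Rightarrow> 'a set \<Rightarrow> 'a set set" where
  "ker_blocks X f A = {fibre X f x |x. x \<in> f ` X \<inter> A}"

abbreviation ker_partition :: "'a set \<Rightarrow> ('a \<Rightarrow> 'a) \<Rightarrow> 'a set set" where
  "ker_partition X f \<equiv> ker_blocks X f X"

definition refines :: "'a set set \<Rightarrow> 'a set set \<Rightarrow> bool" where
  "refines \<A> \<B> \<longleftrightarrow> (\<forall>A\<in>\<A>. \<exists>B\<in>\<B>. A \<subseteq> B)"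

text \<open>
  Equality of collections of blocks means mutual refinement. For blocks of
  partitions it coincides with equality of sets of sets.
\<close>

definition same_blocks :: "'a set set \<Rightarrow> 'a set set \<Rightarrow> bool" where
  "same_blocks \<A> \<B> \<longleftrightarrow> refines \<A> \<B> \<and> refines \<B> \<A>"

lemma same_blocks_ker_blocks_iff:
  "same_blocks (ker_blocks X f A) (ker_blocks X g B) \<longleftrightarrow> ker_blocks X f A = ker_blocks X g B"
proof
  have *: "ker_blocks X f A \<subseteq> ker_blocks X g B"
    if "same_blocks (ker_blocks X f A) (ker_blocks X g B)" for f g A B
  proof
    fix P assume P: "P \<in> ker_blocks X f A"
    with that obtain Q where Q: "Q \<in> ker_blocks X g B" "P \<subseteq> Q"
      unfolding same_blocks_def refines_def by blast
    with that obtain P' where P': "P' \<in> ker_blocks X f A" "Q \<subseteq> P'"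
      unfolding same_blocks_def refines_def by blast
    have "P \<noteq> {}" using P by (auto simp: ker_blocks_def fibre_def)
    moreover have "P \<subseteq> P'" using Q P' by blast
    ultimately have "P = P'"
      using P P'(1) by (auto simp: ker_blocks_def fibre_def)
    then show "P \<in> ker_blocks X g B" using Q P' by auto
  qed
  assume s: "same_blocks (ker_blocks X f A) (ker_blocks X g B)"
  then have "same_blocks (ker_blocks X g B) (ker_blocks X f A)"
    by (simp add: same_blocks_def)
  with s show "ker_blocks X f A = ker_blocks X g B"
    using *[of f A g B] *[of g B f A] by blast
qed (auto simp: same_blocks_def refines_def)

end

theory Submission
  imports Defs
begin

text \<open>
  Each of the two one-sided divisibility relations behind Green's relations is governed by one
  obvious obstruction, and the absence of that obstruction already suffices.

  A map \<open>f\<close> is a left multiple of \<open>g\<close>, that is \<open>f x = g (c x)\<close>, iff every value of \<open>f\<close> is a value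
  of \<open>g\<close> and over each point of \<open>Y\<close> the fibre of \<open>f\<close> inside \<open>Y\<close> is at least as large as that of
  \<open>g\<close>: the factor \<open>c\<close> has to map the former onto the latter, since it maps \<open>Y\<close> onto \<open>Y\<close>, and
  conversely such surjections glue to a factor (\<open>left_multiple_iff\<close>). With the Cantor-Bernstein
  theorem, \<open>\<L>\<close> amounts to equal images and equinumerous fibres in \<open>Y\<close>.

  A map \<open>g\<close> is a right multiple of \<open>f\<close>, that is \<open>g x = d (f x)\<close>, iff the kernel of \<open>f\<close> is contained
  in the kernel of \<open>g\<close>. The factor \<open>d\<close> is then forced on the image of \<open>f\<close>, which contains \<open>Y\<close>, and
  it sends \<open>Y = f(Y)\<close> to \<open>g(Y) = Y\<close> by itself (\<open>right_multiple_iff\<close>). So \<open>\<R>\<close> amounts to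
  \<open>\<pi>(f) = \<pi>(g)\<close>. Finally, the equality of the kernels entails \<open>\<pi>\<^sub>f(Y) = \<pi>\<^sub>g(Y)\<close>: the blocks in
  \<open>\<pi>\<^sub>f(Y)\<close> are exactly the blocks that meet \<open>Y\<close> (\<open>refines_blocks_over_Y\<close>).
\<close>

section \<open>Left multiples and fibres\<close>

lemma lepoll_nonempty_imp_onto:
  assumes "A \<lesssim> B" and "A \<noteq> {}"
  obtains h where "h ` B = A"
proof -
  obtain k where k: "A \<subseteq> k ` B"
    using \<open>A \<lesssim> B\<close> by (auto simp: lepoll_iff)
  obtain a where "a \<in> A"
    using \<open>A \<noteq> {}\<close> by blast
  then have "(\<lambda>z. if k z \<in> A then k z else a) ` B = A"
    using k by (auto simp: image_iff subset_iff)
  then show thesis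
    by (rule that)
qed

text \<open>
  If \<open>f x = g (c x)\<close>, a point \<open>w \<in> Y\<close> over \<open>y\<close> for \<open>g\<close> has the form \<open>c z\<close> with \<open>z \<in> Y\<close>, and then \<open>z\<close>
  lies over \<open>y\<close> for \<open>f\<close>; so \<open>c\<close> is onto fibre by fibre. Conversely, the fibres partition \<open>Y\<close>, so
  surjections between them define \<open>c\<close> on \<open>Y\<close> without conflict; outside \<open>Y\<close> any preimage under \<open>g\<close>
  serves, because \<open>c\<close> is constrained only on \<open>Y\<close>.
\<close>

lemma left_multiple_iff:
  assumes "Y \<subseteq> X" and f: "f \<in> carrier (Omega_bar X Y)" and g: "g \<in> carrier (Omega_bar X Y)"
  shows "(\<exists>c\<in>carrier (Omega_bar X Y). f = c \<otimes>\<^bsub>Omega_bar X Y\<^esub> g) \<longleftrightarrow>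
    f ` X \<subseteq> g ` X \<and> (\<forall>y\<in>Y. fibre Y g y \<lesssim> fibre Y f y)"
proof
  assume "\<exists>c\<in>carrier (Omega_bar X Y). f = c \<otimes>\<^bsub>Omega_bar X Y\<^esub> g"
  then obtain c where c: "c \<in> X \<rightarrow> X" "c ` Y = Y" and "f = compose X g c"
    by (auto simp: Omega_bar_simps)
  then have fc: "f x = g (c x)" if "x \<in> X" for x
    using that by (simp add: compose_eq)
  have "fibre Y g y \<lesssim> fibre Y f y" for y
  proof -
    have "fibre Y g y \<subseteq> c ` fibre Y f y"
    proof
      fix w assume w: "w \<in> fibre Y g y"
      then obtain z where "z \<in> Y" "w = c z"
        using c(2) by (auto simp: fibre_def)
      then show "w \<in> c ` fibre Y f y"
        using w fc \<open>Y \<subseteq> X\<close> by (auto simp: fibre_def)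
    qed
    then show ?thesis
      by (auto simp: lepoll_iff)
  qed
  moreover have "f ` X \<subseteq> g ` X"
    using fc c(1) by auto
  ultimately show "f ` X \<subseteq> g ` X \<and> (\<forall>y\<in>Y. fibre Y g y \<lesssim> fibre Y f y)"
    by blast
next
  assume R: "f ` X \<subseteq> g ` X \<and> (\<forall>y\<in>Y. fibre Y g y \<lesssim> fibre Y f y)"
  have fY: "f ` Y = Y" and gY: "g ` Y = Y" and fE: "f \<in> X \<rightarrow>\<^sub>E X"
    using f g by (auto simp: Omega_bar_simps)
  have "\<exists>h. h ` fibre Y f y = fibre Y g y" if "y \<in> Y" for y
  proof -
    have "fibre Y g y \<noteq> {}"
      using that gY by (force simp: fibre_def)
    then show ?thesis
      using R that lepoll_nonempty_imp_onto by metis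
  qed
  then obtain h where h: "h y ` fibre Y f y = fibre Y g y" if "y \<in> Y" for y
    by metis
  have "\<exists>w\<in>X. f x = g w" if "x \<in> X" for x
    using R that by blast
  then obtain s where s: "s x \<in> X" "f x = g (s x)" if "x \<in> X" for x
    by metis
  define c where "c = (\<lambda>x\<in>X. if x \<in> Y then h (f x) x else s x)"
  have cY: "c x = h (f x) x" if "x \<in> Y" for x
    using that \<open>Y \<subseteq> X\<close> by (auto simp: c_def)
  have hin: "h (f x) x \<in> fibre Y g (f x)" if "x \<in> Y" for x
    using that fY h[of "f x"] by (auto simp: fibre_def)
  have "Y \<subseteq> c ` Y"
  proof
    fix w assume "w \<in> Y"
    then have "g w \<in> Y" "w \<in> fibre Y g (g w)"
      using gY by (auto simp: fibre_def)
    then obtain z where "z \<in> fibre Y f (g w)" "w = h (g w) z"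
      using h by blast
    then show "w \<in> c ` Y"
      using cY[of z] by (intro image_eqI[of _ _ z]) (auto simp: fibre_def)
  qed
  moreover have "c ` Y \<subseteq> Y"
    using cY hin by (auto simp: fibre_def)
  moreover have "c \<in> X \<rightarrow>\<^sub>E X"
    using hin s(1) \<open>Y \<subseteq> X\<close> by (auto 0 3 simp: c_def fibre_def subset_iff)
  ultimately have "c \<in> carrier (Omega_bar X Y)"
    by (auto simp: Omega_bar_simps)
  moreover have "f x = (c \<otimes>\<^bsub>Omega_bar X Y\<^esub> g) x" for x
    using fE hin[of x] s(2)[of x] by (auto simp: Omega_bar_simps compose_def c_def fibre_def)
  ultimately show "\<exists>c\<in>carrier (Omega_bar X Y). f = c \<otimes>\<^bsub>Omega_bar X Y\<^esub> g"
    by blast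
qed

lemma green_L_Omega_bar_iff:
  assumes "Y \<subseteq> X" and "f \<in> carrier (Omega_bar X Y)" and "g \<in> carrier (Omega_bar X Y)"
  shows "(f, g) \<in> green_L (Omega_bar X Y) \<longleftrightarrow>
    f ` X = g ` X \<and> (\<forall>y\<in>Y. fibre Y f y \<approx> fibre Y g y)"
proof -
  have "(f, g) \<in> green_L (Omega_bar X Y) \<longleftrightarrow>
      (\<exists>c\<in>carrier (Omega_bar X Y). f = c \<otimes>\<^bsub>Omega_bar X Y\<^esub> g) \<and>
      (\<exists>d\<in>carrier (Omega_bar X Y). g = d \<otimes>\<^bsub>Omega_bar X Y\<^esub> f)"
    using assms by (auto simp: green_L_def)
  also have "\<dots> \<longleftrightarrow> f ` X = g ` X \<and> (\<forall>y\<in>Y. fibre Y f y \<approx> fibre Y g y)"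
    using assms
    by (auto simp: left_multiple_iff intro: lepoll_antisym eqpoll_imp_lepoll
        eqpoll_imp_lepoll[OF eqpoll_sym])
  finally show ?thesis .
qed

section \<open>Right multiples and kernels\<close>

text \<open>
  Refinement of kernel partitions means inclusion of kernels: the block of \<open>f\<close> that contains \<open>x\<close> can
  only lie in the block of \<open>g\<close> that contains \<open>x\<close>.
\<close>

lemma refines_ker_partition_iff:
  assumes "f ` X \<subseteq> X" and "g ` X \<subseteq> X"
  shows "refines (ker_partition X f) (ker_partition X g) \<longleftrightarrow>
    (\<forall>x\<in>X. \<forall>x'\<in>X. f x = f x' \<longrightarrow> g x = g x')"
proof -
  have *: "ker_partition X k = {fibre X k (k x) |x. x \<in> X}" if "k ` X \<subseteq> X" for k :: "'a \<Rightarrow> 'a"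
    using that by (auto simp: ker_blocks_def)
  have "refines (ker_partition X f) (ker_partition X g) \<longleftrightarrow>
      (\<forall>x\<in>X. \<exists>u\<in>X. fibre X f (f x) \<subseteq> fibre X g (g u))"
    unfolding *[OF assms(1)] *[OF assms(2)] refines_def by blast
  also have "\<dots> \<longleftrightarrow> (\<forall>x\<in>X. \<forall>x'\<in>X. f x = f x' \<longrightarrow> g x = g x')"
  proof (intro iffI ballI impI)
    fix x x'
    assume "\<forall>x\<in>X. \<exists>u\<in>X. fibre X f (f x) \<subseteq> fibre X g (g u)" and x: "x \<in> X" "x' \<in> X" "f x = f x'"
    then obtain u where "fibre X f (f x) \<subseteq> fibre X g (g u)"
      by blast
    with x have "x \<in> fibre X g (g u)" "x' \<in> fibre X g (g u)"
      unfolding fibre_def by auto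
    then show "g x = g x'"
      by (simp add: fibre_def)
  next
    fix x assume "\<forall>x\<in>X. \<forall>x'\<in>X. f x = f x' \<longrightarrow> g x = g x'" and "x \<in> X"
    then have "fibre X f (f x) \<subseteq> fibre X g (g x)"
      unfolding fibre_def by blast
    then show "\<exists>u\<in>X. fibre X f (f x) \<subseteq> fibre X g (g u)"
      using \<open>x \<in> X\<close> by blast
  qed
  finally show ?thesis .
qed

lemma refines_blocks_over_Y:
  assumes "Y \<subseteq> X" and "f ` Y = Y" and "g ` Y = Y"
    and ker: "\<forall>x\<in>X. \<forall>x'\<in>X. f x = f x' \<longrightarrow> g x = g x'"
  shows "refines (ker_blocks X f Y) (ker_blocks X g Y)"
  unfolding refines_def
proof
  fix A assume "A \<in> ker_blocks X f Y"
  then obtain y where y: "y \<in> Y" "A = fibre X f y"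
    unfolding ker_blocks_def by blast
  \<comment> \<open>As \<open>f\<close> maps \<open>Y\<close> onto \<open>Y\<close>, the block \<open>A\<close> contains a point of \<open>Y\<close>, and \<open>g\<close> keeps it in \<open>Y\<close>.\<close>
  obtain z where z: "z \<in> Y" "f z = y"
    using y \<open>f ` Y = Y\<close> by (metis imageE)
  have "A \<subseteq> fibre X g (g z)"
  proof
    fix x assume "x \<in> A"
    then have "x \<in> X" "f x = f z"
      using y(2) z(2) by (simp_all add: fibre_def)
    then have "g x = g z"
      using ker z(1) \<open>Y \<subseteq> X\<close> by blast
    then show "x \<in> fibre X g (g z)"
      using \<open>x \<in> X\<close> by (simp add: fibre_def)
  qed
  moreover have "fibre X g (g z) \<in> ker_blocks X g Y"
    using z \<open>Y \<subseteq> X\<close> \<open>g ` Y = Y\<close> unfolding ker_blocks_def by blast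
  ultimately show "\<exists>B\<in>ker_blocks X g Y. A \<subseteq> B"
    by blast
qed

text \<open>
  Inclusion of kernels is what makes \<open>f x \<mapsto> g x\<close> well defined on the image of \<open>f\<close>. Since
  \<open>Y = f(Y)\<close> lies in that image, the values of the factor elsewhere are free, and the identity
  is chosen there.
\<close>

lemma right_multiple_iff:
  assumes "Y \<subseteq> X" and f: "f \<in> carrier (Omega_bar X Y)" and g: "g \<in> carrier (Omega_bar X Y)"
  shows "(\<exists>d\<in>carrier (Omega_bar X Y). g = f \<otimes>\<^bsub>Omega_bar X Y\<^esub> d) \<longleftrightarrow>
    (\<forall>x\<in>X. \<forall>x'\<in>X. f x = f x' \<longrightarrow> g x = g x')"
proof
  assume "\<exists>d\<in>carrier (Omega_bar X Y). g = f \<otimes>\<^bsub>Omega_bar X Y\<^esub> d"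
  then obtain d where "g = compose X d f"
    unfolding Omega_bar_simps by blast
  then show "\<forall>x\<in>X. \<forall>x'\<in>X. f x = f x' \<longrightarrow> g x = g x'"
    by (simp add: compose_eq)
next
  assume ker: "\<forall>x\<in>X. \<forall>x'\<in>X. f x = f x' \<longrightarrow> g x = g x'"
  have fY: "f ` Y = Y" and gY: "g ` Y = Y" and fE: "f \<in> X \<rightarrow>\<^sub>E X" and gE: "g \<in> X \<rightarrow>\<^sub>E X"
    using f g by (auto simp: Omega_bar_simps)
  define d where "d = (\<lambda>u\<in>X. if u \<in> f ` X then g (inv_into X f u) else u)"
  have df: "d (f x) = g x" if "x \<in> X" for x
  proof -
    have "inv_into X f (f x) \<in> X" "f (inv_into X f (f x)) = f x"
      using that by (auto intro: inv_into_into f_inv_into_f)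
    then have "g (inv_into X f (f x)) = g x"
      using ker that by blast
    then show ?thesis
      using that fE by (auto simp: d_def)
  qed
  have "d ` Y = (\<lambda>x. d (f x)) ` Y"
    using fY by (metis image_image)
  also have "\<dots> = Y"
    using df gY \<open>Y \<subseteq> X\<close> by (metis (no_types, lifting) image_cong subsetD)
  finally have "d ` Y = Y" .
  moreover have "d \<in> X \<rightarrow>\<^sub>E X"
  proof (rule PiE_I)
    fix u assume u: "u \<in> X"
    show "d u \<in> X"
    proof (cases "u \<in> f ` X")
      case True
      then show ?thesis
        using df gE by (metis PiE_mem imageE)
    qed (simp add: d_def u)
  qed (simp add: d_def)
  ultimately have "d \<in> carrier (Omega_bar X Y)"
    by (simp add: Omega_bar_simps)
  moreover have "g x = (f \<otimes>\<^bsub>Omega_bar X Y\<^esub> d) x" for x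
    using gE df[of x] by (auto simp: Omega_bar_simps compose_def)
  ultimately show "\<exists>d\<in>carrier (Omega_bar X Y). g = f \<otimes>\<^bsub>Omega_bar X Y\<^esub> d"
    by blast
qed

lemma green_R_Omega_bar_iff:
  assumes "Y \<subseteq> X" and f: "f \<in> carrier (Omega_bar X Y)" and g: "g \<in> carrier (Omega_bar X Y)"
  shows "(f, g) \<in> green_R (Omega_bar X Y) \<longleftrightarrow>
    same_blocks (ker_partition X f) (ker_partition X g)"
proof -
  have img: "f ` X \<subseteq> X" "g ` X \<subseteq> X"
    using f g by (auto simp: Omega_bar_simps)
  have "(f, g) \<in> green_R (Omega_bar X Y) \<longleftrightarrow>
      (\<exists>c\<in>carrier (Omega_bar X Y). f = g \<otimes>\<^bsub>Omega_bar X Y\<^esub> c) \<and>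
      (\<exists>d\<in>carrier (Omega_bar X Y). g = f \<otimes>\<^bsub>Omega_bar X Y\<^esub> d)"
    using f g by (auto simp: green_R_def)
  also have "\<dots> \<longleftrightarrow> same_blocks (ker_partition X f) (ker_partition X g)"
    unfolding right_multiple_iff[OF \<open>Y \<subseteq> X\<close> g f] right_multiple_iff[OF \<open>Y \<subseteq> X\<close> f g]
      same_blocks_def refines_ker_partition_iff[OF img]
      refines_ker_partition_iff[OF img(2) img(1)]
    by blast
  finally show ?thesis .
qed

lemma same_blocks_over_Y:
  assumes "Y \<subseteq> X" and "f \<in> carrier (Omega_bar X Y)" and "g \<in> carrier (Omega_bar X Y)"
    and "same_blocks (ker_partition X f) (ker_partition X g)"
  shows "same_blocks (ker_blocks X f Y) (ker_blocks X g Y)"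
proof -
  have img: "f ` X \<subseteq> X" "g ` X \<subseteq> X" and Y: "f ` Y = Y" "g ` Y = Y"
    using assms(2,3) by (auto simp: Omega_bar_simps)
  show ?thesis
    using assms(4) refines_blocks_over_Y[OF \<open>Y \<subseteq> X\<close> Y]
      refines_blocks_over_Y[OF \<open>Y \<subseteq> X\<close> Y(2) Y(1)]
    unfolding same_blocks_def refines_ker_partition_iff[OF img]
      refines_ker_partition_iff[OF img(2) img(1)]
    by blast
qed

section \<open>Green's relation \<open>\<H>\<close>\<close>

lemma fibre_restrict: "fibre Y (restrict f Y) y = fibre Y f y"
  by (auto simp: fibre_def)

theorem theorem4p6:
  fixes X Y :: "'a set" and f g :: "'a \<Rightarrow> 'a"
  assumes "X \<noteq> {}" and "Y \<noteq> {}" and "Y \<subseteq> X"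
    and "f \<in> carrier (Omega_bar X Y)" and "g \<in> carrier (Omega_bar X Y)"
  shows "(f, g) \<in> green_H (Omega_bar X Y) \<longleftrightarrow>
    f ` X = g ` X \<and>
    same_blocks (ker_partition X f) (ker_partition X g) \<and>
    same_blocks (ker_blocks X f Y) (ker_blocks X g Y) \<and>
    (\<forall>y\<in>Y. fibre Y (restrict f Y) y \<approx> fibre Y (restrict g Y) y)"
  unfolding green_H_def Int_iff fibre_restrict
    green_L_Omega_bar_iff[OF assms(3-5)] green_R_Omega_bar_iff[OF assms(3-5)]
  using same_blocks_over_Y[OF assms(3-5)] by blast

end
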